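(* Let $h,k\ge 2$ be integers and let $q$ be a prime power with $q\ge hk+1$. Assume that $\mathrm{char}(\mathbb{F}_q)=p\ge h$. Then $\mathcal{P}_{h,k,q}\cup\mathcal{O}_{h-1}$ is a pseudo-arc in $\Sigma\simeq\mathrm{PG}(hk-1,q)$ of size $|\Lambda_{h,q}|+q+1$.
   Context: $\mathrm{PG}(m-1,q)$ is the $(m-1)$-dimensional projective space over $\mathbb{F}_q$; all dimensions are projective. A pseudo-arc in $\mathrm{PG}(hk-1,q)$ is a set of $(h-1)$-dimensional projective subspaces such that every $k$ of them span the entire space. $\Sigma\simeq \mathrm{PG}(hk-1,q)$ is the canonical subgeometry of $\mathrm{PG}(hk-1,q^h)$, consisting of the points $\langle(x_1,\dots,x_{hk})\rangle_{\mathbb{F}_{q^h}}$ with $(x_1,\dots,x_{hk})\in\mathbb{F}_q^{hk}\setminus\{0\}$. It is the set of fixed points of the semilinear collineation $\Psi:\langle(x_1,\dots,x_{hk})\rangle_{\mathbb{F}_{q^h}}\mapsto\langle(x_1^q,\dots,x_{hk}^q)\rangle_{\mathbb{F}_{q^h}}$ of order $h$. For a point $P$ of $\mathrm{PG}(hk-1,q^h)$, $X^*(P):=\langle P,P^{\Psi},\dots,P^{\Psi^{h-1}}\rangle_{\mathbb{F}_{q^h}}$ and $X(P):=X^*(P)\cap\Sigma$, regarded as a subspace of $\Sigma$. For $\alpha\in\mathbb{F}_{q^h}$, $P_\alpha:=\langle(1,\alpha,\alpha^2,\dots,\alpha^{hk-1})\rangle_{\mathbb{F}_{q^h}}$. $\Lambda_{h,q}$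 is a set of representatives of the orbits of size $h$ of $\mathbb{F}_{q^h}$ under $x\mapsto x^q$, and $\mathcal{P}_{h,k,q}:=\{X(P_\alpha):\alpha\in\Lambda_{h,q}\}$. Osculating spaces: let $\nu_{hk,q}(u,t)=\langle(u^{hk-1},u^{hk-2}t,\dots,ut^{hk-2},t^{hk-1})\rangle_{\mathbb{F}_q}$ for $(u,t)\in\mathbb{F}_q^2\setminus\{(0,0)\}$. For $t\in\mathbb{F}_q$, $\mathrm{Osc}_{h-1}(\nu_{hk,q}(1,t))$ is the $(h-1)$-dimensional subspace of $\Sigma$ spanned by the vector $(1,t,t^2,\dots,t^{hk-1})$ and its (formal, coordinatewise) derivatives with respect to $t$ of orders $1,\dots,h-1$. $\mathrm{Osc}_{h-1}(\nu_{hk,q}(0,1))$ is the $(h-1)$-dimensional subspace spanned by $(u^{hk-1},u^{hk-2},\dots,u,1)$ and its derivatives with respect to $u$ of orders $1,\dots,h-1$, all evaluated at $u=0$; equivalently, it is spanned by the last $h$ standard basis vectors. Finally, $$\mathcal{O}_{h-1}:=\{\mathrm{Osc}_{h-1}(\nu_{hk,q}(1,t)):t\in\mathbb{F}_q\}\cup\{\mathrm{Osc}_{h-1}(\nu_{hk,q}(0,1))\}.$$ *)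

theory Defs
  imports
    "Jordan_Normal_Form.VS_Connect"
    "HOL-Library.Cardinality"
    "HOL-Combinatorics.Orbits"
    "HOL-Computational_Algebra.Polynomial"
begin

text \<open>
  A projective subspace of $\mathrm{PG}(n-1,F)$ is identified with the linear subspace of
  $F^n$ underlying it; its projective dimension is one less than its linear dimension.
  In particular a point is a one-dimensional linear subspace.
\<close>

definition vspan :: "nat \<Rightarrow> 'a::field vec set \<Rightarrow> 'a vec set" where
  "vspan n S = LinearCombinations.module.span class_ring (module_vec TYPE('a) n) S"

definition proj_subspace :: "nat \<Rightarrow> nat \<Rightarrow> 'a::field vec set \<Rightarrow> bool" where
  "proj_subspace n d U \<longleftrightarrow>
     VectorSpace.subspace class_ring U (module_vec TYPE('a) n) \<and>
     vectorspace.dim class_ring ((module_vec TYPE('a) n)\<lparr>carrier := U\<rparr>) = d + 1"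

definition pseudo_arc :: "nat \<Rightarrow> nat \<Rightarrow> 'a::field vec set set \<Rightarrow> bool" where
  "pseudo_arc h k A \<longleftrightarrow>
     (\<forall>U\<in>A. proj_subspace (h * k) (h - 1) U) \<and>
     (\<forall>B\<subseteq>A. card B = k \<longrightarrow> vspan (h * k) (\<Union>B) = carrier_vec (h * k))"

text \<open>
  Below \<open>'a\<close> plays the role of $\mathbb{F}_q$, \<open>'b\<close> that of $\mathbb{F}_{q^h}$, and
  \<open>\<iota>\<close> is the inclusion of the former field into the latter.
\<close>

text \<open>The semilinear collineation, acting on sets of vectors, hence on points.\<close>

definition Psi :: "nat \<Rightarrow> 'b::field vec set \<Rightarrow> 'b vec set" where
  "Psi q P = map_vec (\<lambda>x. x ^ q) ` P"

definition X_star :: "nat \<Rightarrow> nat \<Rightarrow> nat \<Rightarrow> 'b::field vec set \<Rightarrow> 'b vec set" where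
  "X_star n h q P = vspan n (\<Union>i<h. (Psi q ^^ i) P)"

text \<open>
  The intersection with the canonical subgeometry, regarded as a subspace of it: the vectors
  over the small field whose image under \<open>\<iota>\<close> lies in \<open>X_star\<close>.
\<close>

definition X_sub ::
  "('a::field \<Rightarrow> 'b::field) \<Rightarrow> nat \<Rightarrow> nat \<Rightarrow> nat \<Rightarrow> 'b vec set \<Rightarrow> 'a vec set" where
  "X_sub \<iota> n h q P = {v \<in> carrier_vec n. map_vec \<iota> v \<in> X_star n h q P}"

definition P_pt :: "nat \<Rightarrow> 'b::field \<Rightarrow> 'b vec set" where
  "P_pt n \<alpha> = vspan n {vec n (\<lambda>i. \<alpha> ^ i)}"

definition full_orbits :: "nat \<Rightarrow> nat \<Rightarrow> 'b::field set set" where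
  "full_orbits h q = {Q. (\<exists>x. Q = orbit (\<lambda>y. y ^ q) x) \<and> card Q = h}"

definition orbit_reps :: "nat \<Rightarrow> nat \<Rightarrow> 'b::field set \<Rightarrow> bool" where
  "orbit_reps h q L \<longleftrightarrow>
     L \<subseteq> \<Union>(full_orbits h q) \<and> (\<forall>Q\<in>full_orbits h q. \<exists>!\<alpha>. \<alpha> \<in> L \<inter> Q)"

definition P_family ::
  "('a::field \<Rightarrow> 'b::field) \<Rightarrow> nat \<Rightarrow> nat \<Rightarrow> nat \<Rightarrow> 'b set \<Rightarrow> 'a vec set set" where
  "P_family \<iota> h k q L = (\<lambda>\<alpha>. X_sub \<iota> (h * k) h q (P_pt (h * k) \<alpha>)) ` L"

text \<open>
  The span of the formal derivatives of orders $0,\dots,h-1$, evaluated at \<open>t\<close>, of a curve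
  given by a vector \<open>c\<close> of coordinate polynomials.
\<close>

definition osc :: "nat \<Rightarrow> nat \<Rightarrow> 'a::field poly vec \<Rightarrow> 'a \<Rightarrow> 'a vec set" where
  "osc n h c t = vspan n ((\<lambda>j. map_vec (\<lambda>f. poly ((pderiv ^^ j) f) t) c) ` {..<h})"

text \<open>
  The curve is \<open>(1, t, \<dots>, t ^ (n - 1))\<close> in the chart of the points \<open>(1, t)\<close>, and
  \<open>(u ^ (n - 1), \<dots>, u, 1)\<close>, taken at \<open>u = 0\<close>, for the point \<open>(0, 1)\<close>.
\<close>

definition O_family :: "nat \<Rightarrow> nat \<Rightarrow> 'a::field vec set set" where
  "O_family h k =
     range (osc (h * k) h (vec (h * k) (\<lambda>i. monom 1 i))) \<union>
     {osc (h * k) h (vec (h * k) (\<lambda>i. monom 1 (h * k - 1 - i))) 0}"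

end

theory Submission
  imports "Jordan_Normal_Form.Char_Poly" Defs
begin

text \<open>
  Put \<open>n = h * k\<close>. A vector of \<open>n\<close> coefficients is at the same time a linear form on the ambient
  space and a polynomial of degree below \<open>n\<close>, that is, a binary form of degree \<open>n - 1\<close>. Under
  this dictionary a linear form annihilates
  
    \<^item> the osculating space at a rational \<open>t\<close> only if the polynomial vanishes at \<open>t\<close> to order at
      least \<open>h\<close>: the \<open>j\<close>-th derivative is \<open>fact j\<close> times a Taylor coefficient, and \<open>fact j\<close> is
      invertible for \<open>j < h \<le> p\<close>;
  
    \<^item> the osculating space at \<open>(0, 1)\<close> only if the degree is below \<open>n - h\<close>, which is vanishing to
      order at least \<open>h\<close> at infinity;
  
    \<^item> the space \<open>X(P\<^sub>\<alpha>)\<close> only if the polynomial vanishes at \<open>\<alpha>\<close>, hence at all its \<open>h\<close> conjugates.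
  
  In every case the form has zeros of total multiplicity at least \<open>h\<close> on one orbit of the
  Frobenius map on the projective line over the big field, and different members of the family
  belong to different orbits. A nonzero form that annihilates \<open>k\<close> members would therefore have
  \<open>h * k\<close> zeros, more than its degree \<open>n - 1\<close> (\<open>zero_order_if_annihilates\<close>,
  \<open>sum_zero_order_le\<close>). So any \<open>k\<close> members span.
  
  For the dimensions and the number of members it then suffices that every member has
  dimension at most \<open>h\<close>: if \<open>k\<close> spaces of dimension at most \<open>h\<close> span a space of dimension
  \<open>h * k\<close>, then they are pairwise distinct and all have dimension \<open>h\<close>
  (\<open>pseudo_arc_of_spanning_family\<close>). For an osculating space the bound is the number of generators;
  for \<open>X(P\<^sub>\<alpha>)\<close> it holds because the coordinates satisfy a linear recurrence of order \<open>h\<close>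
  (\<open>X_determined_by_prefix\<close>).
  
  The third item above needs enough vectors in \<open>X(P\<^sub>\<alpha>)\<close>. The vectors of traces
  \<open>tr (\<beta> * \<alpha> ^ i)\<close> suffice: a form with polynomial \<open>F\<close> takes the value \<open>tr (\<beta> * F(\<alpha>))\<close> on them, and the
  trace is not identically zero (\<open>annihilator_X\<close>).
\<close>

section \<open>Spanning, annihilating forms and dimensions\<close>

text \<open>
  Fewer than \<open>n\<close> homogeneous equations in \<open>n\<close> unknowns: the coefficient matrix, padded with zero
  rows to a square matrix, is singular.
\<close>

lemma exists_nonzero_orthogonal:
  fixes T :: "'a::field vec set"
  assumes T: "finite T" "T \<subseteq> carrier_vec n" and card: "card T < n"
  shows "\<exists>f\<in>carrier_vec n. f \<noteq> 0\<^sub>v n \<and> (\<forall>v\<in>T. f \<bullet> v = 0)"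
proof -
  obtain ts where ts: "set ts = T" "length ts = card T"
    using T(1) finite_distinct_list distinct_card by metis
  define c where "c i = (if i < length ts then ts ! i else 0\<^sub>v n)" for i
  have c: "c i \<in> carrier_vec n" for i
    using ts(1) T(2) nth_mem[of i ts] by (auto simp: c_def)
  \<comment> \<open>The last row is zero; it is not among the rows that come from \<open>T\<close> since \<open>card T < n\<close>.\<close>
  define A where "A = mat\<^sub>r n n (\<lambda>i. if i = n - 1 then 0\<^sub>v n else c i)"
  have A: "A \<in> carrier_mat n n"
    by (simp add: A_def)
  have "det A = 0"
    unfolding A_def using card c by (intro det_row_0) auto
  then obtain f where f: "f \<in> carrier_vec n" "f \<noteq> 0\<^sub>v n" "A *\<^sub>v f = 0\<^sub>v n"
    using det_0_iff_vec_prod_zero_field[OF A] by auto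
  have "f \<bullet> v = 0" if vT: "v \<in> T" for v
  proof -
    obtain i where i: "i < length ts" "ts ! i = v"
      using vT ts(1) by (auto simp: in_set_conv_nth)
    have v: "v \<in> carrier_vec n"
      using vT T by auto
    have "row A i = v"
      using i card ts v by (auto simp: A_def c_def)
    moreover have "row A i \<bullet> f = (A *\<^sub>v f) $ i"
      using A i card ts by simp
    ultimately have "v \<bullet> f = 0"
      using f(3) i card ts by simp
    then show ?thesis
      using f(1) v by (simp add: comm_scalar_prod)
  qed
  with f show ?thesis by auto
qed

context vec_space
begin

text \<open>
  Connects the dimension of \<open>W\<close> as a space in its own right with independence and span in the
  ambient space, so that later arguments stay in the ambient space.
\<close>

lemma subspace_basis:
  assumes W: "subspace class_ring W V"
  obtains B where "finite B" "B \<subseteq> W" "lin_indpt B" "span B = W"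
    "card B = vectorspace.dim class_ring (vs W)" "B \<subseteq> carrier_vec n"
proof -
  have sm: "submodule class_ring W V"
    using W by (simp add: subspace_def)
  have Wc: "W \<subseteq> carrier_vec n"
    using sm by (simp add: submodule_def)
  have "\<exists>B. finite B \<and> maximal B (\<lambda>S. S \<subseteq> W \<and> lin_indpt S)"
  proof (rule maximal_exists)
    fix S assume "S \<subseteq> W \<and> lin_indpt S"
    then show "finite S \<and> card S \<le> dim"
      using Wc li_le_dim[OF fin_dim, of S] by auto
  next
    show "{} \<subseteq> W \<and> lin_indpt {}"
      by (simp add: lin_dep_def)
  qed
  then obtain B where B: "finite B" "maximal B (\<lambda>S. S \<subseteq> W \<and> lin_indpt S)"
    by blast
  then have BW: "B \<subseteq> W" and li: "lin_indpt B"
    by (auto simp: maximal_def)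
  have sub: "span B \<subseteq> W"
    using BW sm by (rule span_is_subset)
  interpret W: vectorspace class_ring "vs W"
    using W by (rule subspace_is_vs)
  have "W.basis B"
  proof (rule W.max_li_is_basis)
    have "maximal B (\<lambda>S. S \<subseteq> W \<and> \<not> W.lin_dep S)"
      using B(2) span_li_not_depend(2)[OF _ sm] unfolding maximal_def by auto
    then show "maximal B (\<lambda>S. S \<subseteq> carrier (vs W) \<and> \<not> W.lin_dep S)"
      by simp
  qed
  moreover have "W.span B = span B"
    using span_li_not_depend(1)[OF BW sm] by simp
  ultimately have "span B = W"
    by (simp add: W.basis_def)
  moreover have "card B = W.dim"
    using W.dim_basis[OF B(1) \<open>W.basis B\<close>] by simp
  ultimately show thesis
    using that B BW li Wc by blast
qed

text \<open>
  The criterion through which every spanning claim below is reduced to a statement about linear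
  forms, and hence about polynomials.
\<close>

lemma span_eq_carrier_if_orthogonal_trivial:
  assumes S: "S \<subseteq> carrier_vec n"
    and triv: "\<And>f. f \<in> carrier_vec n \<Longrightarrow> (\<forall>v\<in>S. f \<bullet> v = 0) \<Longrightarrow> f = 0\<^sub>v n"
  shows "span S = carrier_vec n"
proof -
  have "subspace class_ring (span S) V"
    using S by (intro span_is_subspace) simp
  then obtain B where B: "finite B" "B \<subseteq> span S" "lin_indpt B" "span B = span S"
    "B \<subseteq> carrier_vec n"
    by (rule subspace_basis)
  have "\<not> card B < n"
  proof
    assume "card B < n"
    then obtain f where f: "f \<in> carrier_vec n" "f \<noteq> 0\<^sub>v n" "\<forall>v\<in>B. f \<bullet> v = 0"
      using exists_nonzero_orthogonal[OF B(1,5)] by blast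
    then have "f \<in> orthogonal_complement B"
      by (simp add: orthogonal_complement_def)
    then have "f \<in> orthogonal_complement S"
      using B(4) in_orthogonal_complement_span[OF B(5)] in_orthogonal_complement_span[OF S] by auto
    then show False
      using f triv by (auto simp: orthogonal_complement_def)
  qed
  then have "basis B"
    using B dim_is_n by (intro dim_li_is_basis) auto
  then show ?thesis
    using B(4) by (simp add: basis_def)
qed

text \<open>
  If an independent set had more than \<open>h\<close> elements, then the \<open>h\<close> equations saying that the first
  \<open>h\<close> coordinates of a combination vanish would have a nontrivial solution; by \<open>inj\<close> this
  solution would be a dependence.
\<close>

lemma dim_le_if_determined_by_prefix:
  assumes W: "subspace class_ring W V" and hn: "h \<le> n"
    and inj: "\<And>w. w \<in> W \<Longrightarrow> (\<forall>i<h. w $ i = 0) \<Longrightarrow> w = 0\<^sub>v n"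
  shows "vectorspace.dim class_ring (vs W) \<le> h"
proof (rule ccontr)
  assume large: "\<not> ?thesis"
  obtain B where B: "finite B" "B \<subseteq> W" "lin_indpt B" "span B = W"
    "card B = vectorspace.dim class_ring (vs W)" "B \<subseteq> carrier_vec n"
    using subspace_basis[OF W] .
  obtain bs where bs: "set bs = B" "distinct bs" "length bs = card B"
    using B(1) finite_distinct_list distinct_card by metis
  define m where "m = length bs"
  have "h < m"
    using large B(5) bs(3) by (simp add: m_def)
  \<comment> \<open>The equations: one for each of the first \<open>h\<close> coordinates, in one unknown per basis vector.\<close>
  define R where "R = (\<lambda>i. vec m (\<lambda>j. bs ! j $ i)) ` {..<h}"
  have "card R \<le> h"
    using card_image_le[of "{..<h}"] by (auto simp: R_def)
  then have "card R < m"
    using \<open>h < m\<close> by simp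
  moreover have "finite R" "R \<subseteq> carrier_vec m"
    by (auto simp: R_def)
  ultimately obtain f where f: "f \<in> carrier_vec m" "f \<noteq> 0\<^sub>v m" "\<forall>v\<in>R. f \<bullet> v = 0"
    using exists_nonzero_orthogonal[of R m] by blast
  define a where "a b = f $ (THE j. j < m \<and> bs ! j = b)" for b
  have a: "a (bs ! j) = f $ j" if "j < m" for j
  proof -
    have "(THE i. i < m \<and> bs ! i = bs ! j) = j"
      using that bs(2) by (intro the_equality) (auto simp: m_def nth_eq_iff_index_eq)
    then show ?thesis by (simp add: a_def)
  qed
  have bij: "bij_betw ((!) bs) {..<m} B"
    using bs by (simp add: m_def bij_betw_nth)
  have "lincomb a B \<in> span B"
    unfolding span_def by (simp, rule exI[of _ a], rule exI[of _ B]) (use B(1) in simp)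
  moreover have "lincomb a B $ i = 0" if "i < h" for i
  proof -
    have "lincomb a B $ i = (\<Sum>b\<in>B. a b * b $ i)"
      using that hn B(6) by (intro lincomb_index) auto
    also have "\<dots> = (\<Sum>j<m. a (bs ! j) * bs ! j $ i)"
      using bij by (rule sum.reindex_bij_betw[symmetric])
    also have "\<dots> = f \<bullet> vec m (\<lambda>j. bs ! j $ i)"
      by (auto simp: scalar_prod_def a lessThan_atLeast0 intro!: sum.cong)
    also have "\<dots> = 0"
      using f(3) that by (auto simp: R_def)
    finally show ?thesis .
  qed
  ultimately have "lincomb a B = 0\<^sub>v n"
    using inj B(4) by auto
  moreover have "\<exists>j<m. f $ j \<noteq> 0"
  proof (rule ccontr)
    assume "\<not> ?thesis"
    then have "f = 0\<^sub>v m"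
      using f(1) by (intro eq_vecI) auto
    then show False
      using f(2) by simp
  qed
  then obtain j where j: "j < m" "f $ j \<noteq> 0" by blast
  then have "bs ! j \<in> B" "a (bs ! j) \<noteq> 0"
    using a[OF j(1)] bs(1) by (auto simp: m_def)
  ultimately have "lin_dep B"
    unfolding lin_dep_def using B(1)
    by (intro exI[of _ B] exI[of _ a] exI[of _ "bs ! j"]) simp
  with B(3) show False ..
qed

end

text \<open>
  For \<open>k\<close> indices \<open>J\<close> the union of bases of the spaces in \<open>U ` J\<close> spans, so
  \<open>h * k \<le> (\<Sum>W\<in>U ` J. dim W) \<le> h * card (U ` J) \<le> h * k\<close>, and equality must hold throughout.
  Therefore \<open>U\<close> is injective on \<open>J\<close> and all dimensions are \<open>h\<close>. Since \<open>k \<ge> 2\<close>, any two indices lie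
  in a common \<open>J\<close>, which makes \<open>U\<close> injective on the whole index set.
\<close>

lemma pseudo_arc_of_spanning_family:
  fixes U :: "'i \<Rightarrow> 'a::field vec set"
  assumes h: "h \<ge> 1" and k: "k \<ge> 2" and finI: "finite I" and cardI: "card I \<ge> k"
    and subU: "\<And>i. i \<in> I \<Longrightarrow> VectorSpace.subspace class_ring (U i) (module_vec TYPE('a) (h * k))"
    and dimU: "\<And>i. i \<in> I \<Longrightarrow>
      vectorspace.dim class_ring ((module_vec TYPE('a) (h * k))\<lparr>carrier := U i\<rparr>) \<le> h"
    and spans: "\<And>J. J \<subseteq> I \<Longrightarrow> card J = k \<Longrightarrow>
      vspan (h * k) (\<Union>i\<in>J. U i) = carrier_vec (h * k)"
  shows "pseudo_arc h k (U ` I)" and "card (U ` I) = card I"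
proof -
  interpret vec_space "TYPE('a)" "h * k" .
  have J: "card (U ` J) = k \<and> (\<forall>i\<in>J. vectorspace.dim class_ring (vs (U i)) = h)"
    if JI: "J \<subseteq> I" and cJ: "card J = k" for J
  proof -
    have finJ: "finite J"
      using JI finI by (rule finite_subset)
    have "\<exists>B. finite B \<and> span B = W \<and> card B = vectorspace.dim class_ring (vs W) \<and>
        B \<subseteq> carrier_vec (h * k)" if "W \<in> U ` J" for W
    proof -
      have "subspace class_ring W V"
        using that JI subU by auto
      then show ?thesis by (rule subspace_basis) blast
    qed
    then obtain b where b: "\<And>W. W \<in> U ` J \<Longrightarrow> finite (b W) \<and> span (b W) = W \<and>
        card (b W) = vectorspace.dim class_ring (vs W) \<and> b W \<subseteq> carrier_vec (h * k)"
      by metis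
    define S where "S = (\<Union>W\<in>U ` J. b W)"
    have S: "S \<subseteq> carrier_vec (h * k)" "finite S"
      using b finJ by (auto simp: S_def)
    have "(\<Union>i\<in>J. U i) \<subseteq> span S"
    proof
      fix v assume "v \<in> (\<Union>i\<in>J. U i)"
      then obtain W where W: "W \<in> U ` J" "v \<in> W" by auto
      then have "span (b W) \<subseteq> span S"
        using b by (intro span_is_monotone) (auto simp: S_def)
      then show "v \<in> span S"
        using b W by auto
    qed
    then have "span (\<Union>i\<in>J. U i) \<subseteq> span S"
      using S by (intro span_is_subset span_is_submodule) auto
    moreover have "span S \<subseteq> carrier_vec (h * k)"
      using S(1) by (intro span_is_subset2) simp
    ultimately have "span S = carrier_vec (h * k)"
      using spans[OF JI cJ] by (auto simp: vspan_def)
    then have "h * k \<le> card S"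
      using gen_ge_dim[of S] S dim_is_n by simp
    also have "\<dots> \<le> (\<Sum>W\<in>U ` J. card (b W))"
      unfolding S_def using finJ by (intro card_UN_le) auto
    also have "\<dots> = (\<Sum>W\<in>U ` J. vectorspace.dim class_ring (vs W))"
      using b by (intro sum.cong) auto
    finally have low: "h * k \<le> (\<Sum>W\<in>U ` J. vectorspace.dim class_ring (vs W))" .
    have dimJ: "vectorspace.dim class_ring (vs W) \<le> h" if "W \<in> U ` J" for W
      using that JI dimU by auto
    have "(\<Sum>W\<in>U ` J. vectorspace.dim class_ring (vs W)) \<le> h * card (U ` J)"
      using sum_bounded_above[of "U ` J", OF dimJ] by (simp add: mult.commute)
    with low have "h * k \<le> h * card (U ` J)"
      by (rule order_trans)
    then have cU: "card (U ` J) = k"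
      using h card_image_le[OF finJ, of U] cJ by simp
    have "vectorspace.dim class_ring (vs W) = h" if W: "W \<in> U ` J" for W
    proof (rule ccontr)
      assume "\<not> ?thesis"
      then have "vectorspace.dim class_ring (vs W) < h"
        using dimJ[OF W] by simp
      then have "(\<Sum>W\<in>U ` J. vectorspace.dim class_ring (vs W)) < (\<Sum>W\<in>U ` J. h)"
        using finJ W dimJ by (intro sum_strict_mono_ex1) auto
      then show False
        using low cU by (simp add: mult.commute)
    qed
    then show ?thesis using cU by auto
  qed
  have extend: "\<exists>J. J \<subseteq> I \<and> card J = k \<and> i \<in> J \<and> j \<in> J" if "i \<in> I" "j \<in> I" for i j
  proof -
    have "card {i, j} \<le> k"
      using k card_insert_le_m1[of 2 "{j}" i] by (cases "i = j") auto
    then show ?thesis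
      using exists_subset_between[of "{i, j}" k I] that cardI finI by auto
  qed
  have inj: "inj_on U I"
  proof (rule inj_onI)
    fix i j assume ij: "i \<in> I" "j \<in> I" "U i = U j"
    then obtain J0 where J0: "J0 \<subseteq> I" "card J0 = k" "i \<in> J0" "j \<in> J0"
      using extend by blast
    then have "inj_on U J0"
      using J finI by (intro eq_card_imp_inj_on) (auto intro: finite_subset)
    then show "i = j"
      using J0 ij by (auto dest: inj_onD)
  qed
  then show "card (U ` I) = card I"
    by (rule card_image)
  show "pseudo_arc h k (U ` I)"
    unfolding pseudo_arc_def
  proof (intro conjI ballI allI impI)
    fix W assume "W \<in> U ` I"
    then obtain i where i: "i \<in> I" "W = U i" by auto
    then show "proj_subspace (h * k) (h - 1) W"
      using extend[of i i] J subU[of i] h by (auto simp: proj_subspace_def)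
  next
    fix B assume B: "B \<subseteq> U ` I" "card B = k"
    then obtain J0 where J0: "J0 \<subseteq> I" "B = U ` J0"
      by (meson subset_imageE)
    moreover have "card J0 = k"
      using J0 B(2) inj card_image[of U J0] inj_on_subset by metis
    ultimately show "vspan (h * k) (\<Union>B) = carrier_vec (h * k)"
      using spans[of J0] by simp
  qed
qed

section \<open>Osculating spaces and orders of vanishing\<close>

definition vec_poly :: "'a::comm_ring_1 vec \<Rightarrow> 'a poly" where
  "vec_poly f = (\<Sum>i<dim_vec f. monom (f $ i) i)"

lemma coeff_vec_poly: "coeff (vec_poly f) i = (if i < dim_vec f then f $ i else 0)"
proof -
  have "coeff (vec_poly f) i = (\<Sum>j<dim_vec f. if j = i then f $ j else 0)"
    by (simp add: vec_poly_def coeff_sum coeff_monom)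
  then show ?thesis by (simp add: sum.delta)
qed

lemma poly_vec_poly: "poly (vec_poly f) x = (\<Sum>i<dim_vec f. f $ i * x ^ i)"
  by (simp add: vec_poly_def poly_sum poly_monom)

lemma vec_poly_eq_0_iff:
  assumes "f \<in> carrier_vec n"
  shows "vec_poly f = 0 \<longleftrightarrow> f = 0\<^sub>v n"
proof
  assume "vec_poly f = 0"
  then have "f $ i = 0" if "i < n" for i
    using assms that coeff_vec_poly[of f i] by simp
  then show "f = 0\<^sub>v n"
    using assms by (intro eq_vecI) auto
next
  assume "f = 0\<^sub>v n"
  then show "vec_poly f = 0"
    by (intro poly_eqI) (simp add: coeff_vec_poly)
qed

lemma degree_vec_poly_le:
  assumes "f \<in> carrier_vec n"
  shows "degree (vec_poly f) \<le> n - 1"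
  using assms by (intro degree_le) (auto simp: coeff_vec_poly)

lemma poly_higher_pderiv_0:
  fixes p :: "'a::field poly"
  shows "poly ((pderiv ^^ j) p) 0 = of_nat (fact j) * coeff p j"
proof -
  have "poly ((pderiv ^^ j) p) 0 = pochhammer (of_nat 1) j * coeff p j"
    by (simp add: poly_0_coeff_0 coeff_higher_pderiv)
  also have "pochhammer (of_nat 1) j = (of_nat (fact j) :: 'a)"
    by (simp only: pochhammer_of_nat pochhammer_fact)
  finally show ?thesis .
qed

text \<open>
  Translation moves the expansion point to \<open>0\<close>, where derivatives and coefficients correspond.
\<close>

lemma higher_pderiv_pcompose_shift:
  "(pderiv ^^ j) (pcompose p [:t, 1:]) = pcompose ((pderiv ^^ j) p) [:t, 1 :: 'a::field:]"
  by (induction j) (simp_all add: pderiv_pcompose pderiv_pCons)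

text \<open>
  Taylor expansion at \<open>t\<close>. In positive characteristic the derivative of order \<open>j\<close> determines the
  Taylor coefficient of index \<open>j\<close> only when \<open>fact j\<close> is nonzero in the field.
\<close>

lemma power_dvd_if_higher_pderivs_vanish:
  fixes p :: "'a::field poly"
  assumes zero: "\<And>j. j < h \<Longrightarrow> poly ((pderiv ^^ j) p) t = 0"
    and fact: "\<And>j. j < h \<Longrightarrow> of_nat (fact j) \<noteq> (0 :: 'a)"
  shows "[:- t, 1:] ^ h dvd p"
proof -
  define r where "r = pcompose p [:t, 1:]"
  have "coeff r j = 0" if "j < h" for j
  proof -
    have "of_nat (fact j) * coeff r j = poly ((pderiv ^^ j) p) t"
      unfolding r_def by (subst poly_higher_pderiv_0[symmetric])
        (simp add: higher_pderiv_pcompose_shift poly_pcompose)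
    then show ?thesis
      using zero[OF that] fact[OF that] by simp
  qed
  then have "monom 1 h dvd r"
    by (simp add: monom_1_dvd_iff')
  then obtain s where "r = [:0, 1:] ^ h * s"
    by (auto simp: monom_altdef dvd_def)
  moreover have "p = pcompose r [:- t, 1:]"
    by (simp add: r_def pcompose_assoc[symmetric] pcompose_pCons)
  moreover have "pcompose ([:0, 1:] ^ h) u = u ^ h" for u :: "'a poly"
    by (induction h) (simp_all add: pcompose_mult pcompose_pCons pcompose_1)
  ultimately have "p = [:- t, 1:] ^ h * pcompose s [:- t, 1:]"
    by (simp add: pcompose_mult)
  then show ?thesis
    by (rule dvdI)
qed

text \<open>
  Differentiation is linear and acts on each coordinate, so a linear form applied to a derivative
  of the curve is the derivative of its polynomial.
\<close>

lemma scalar_prod_moment_curve_derivative: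
  fixes f :: "'a::field vec"
  assumes "f \<in> carrier_vec n"
  shows "f \<bullet> map_vec (\<lambda>g. poly ((pderiv ^^ j) g) t) (vec n (\<lambda>i. monom 1 i)) =
    poly ((pderiv ^^ j) (vec_poly f)) t"
proof -
  have "vec_poly f = (\<Sum>i<n. Polynomial.smult (f $ i) (monom 1 i))"
    using assms by (simp add: vec_poly_def smult_monom)
  then show ?thesis
    by (simp add: scalar_prod_def higher_pderiv_sum higher_pderiv_smult poly_sum
        lessThan_atLeast0)
qed

lemma scalar_prod_reversed_moment_curve_derivative:
  fixes f :: "'a::field vec"
  assumes f: "f \<in> carrier_vec n" and j: "j < n"
  shows "f \<bullet> map_vec (\<lambda>g. poly ((pderiv ^^ j) g) 0) (vec n (\<lambda>i. monom 1 (n - 1 - i))) =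
    of_nat (fact j) * f $ (n - 1 - j)"
proof -
  have "f \<bullet> map_vec (\<lambda>g. poly ((pderiv ^^ j) g) 0) (vec n (\<lambda>i. monom 1 (n - 1 - i))) =
      (\<Sum>i<n. f $ i * (of_nat (fact j) * coeff (monom 1 (n - 1 - i)) j))"
    by (simp add: scalar_prod_def poly_higher_pderiv_0 lessThan_atLeast0)
  also have "\<dots> = (\<Sum>i<n. if i = n - 1 - j then of_nat (fact j) * f $ i else 0)"
    using j by (intro sum.cong) (auto simp: coeff_monom)
  also have "\<dots> = of_nat (fact j) * f $ (n - 1 - j)"
    using j by (simp add: sum.delta)
  finally show ?thesis .
qed

lemma (in vec_space) dim_span_le_card:
  assumes "finite S" "S \<subseteq> carrier_vec n"
  shows "vectorspace.dim class_ring (vs (span S)) \<le> card S"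
proof -
  have sub: "subspace class_ring (span S) V"
    using assms by (intro span_is_subspace) simp
  then interpret W: vectorspace class_ring "vs (span S)"
    by (rule subspace_is_vs)
  have "S \<subseteq> span S"
    using assms by (intro in_own_span) simp
  moreover from this have "W.span S = span S"
    using sub span_li_not_depend(1) by (simp add: subspace_def)
  ultimately show ?thesis
    using assms(1) by (intro W.gen_ge_dim) auto
qed

lemma osc_subspace:
  assumes "dim_vec c = n"
  shows "VectorSpace.subspace class_ring (osc n h c t) (module_vec TYPE('a::field) n)"
    and "vectorspace.dim class_ring ((module_vec TYPE('a) n)\<lparr>carrier := osc n h c t\<rparr>) \<le> h"
proof -
  interpret vec_space "TYPE('a)" n .
  define S where "S = (\<lambda>j. map_vec (\<lambda>f. poly ((pderiv ^^ j) f) t) c) ` {..<h}"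
  have S: "S \<subseteq> carrier_vec n" "finite S"
    using assms by (auto simp: S_def)
  have osc: "osc n h c t = span S"
    by (simp add: osc_def S_def vspan_def)
  show "VectorSpace.subspace class_ring (osc n h c t) V"
    unfolding osc using S(1) by (intro span_is_subspace) simp
  have "card S \<le> card {..<h}"
    unfolding S_def by (rule card_image_le) simp
  then show "vectorspace.dim class_ring (vs (osc n h c t)) \<le> h"
    unfolding osc using dim_span_le_card[OF S(2,1)] by simp
qed

lemma in_osc:
  assumes "dim_vec c = n" "j < h"
  shows "map_vec (\<lambda>f. poly ((pderiv ^^ j) f) t) c \<in> osc n h c (t :: 'a::field)"
proof -
  interpret vec_space "TYPE('a)" n .
  define S where "S = (\<lambda>j. map_vec (\<lambda>f. poly ((pderiv ^^ j) f) t) c) ` {..<h}"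
  have "S \<subseteq> carrier_vec n"
    using assms by (auto simp: S_def)
  then have "S \<subseteq> span S"
    by (intro in_own_span) simp
  moreover have "map_vec (\<lambda>f. poly ((pderiv ^^ j) f) t) c \<in> S"
    using assms(2) by (simp add: S_def)
  ultimately show ?thesis
    by (auto simp: osc_def vspan_def S_def)
qed

section \<open>The Frobenius map and the trace\<close>

text \<open>
  Multiplication by a nonzero \<open>x\<close> permutes the nonzero elements, so their product is unchanged
  when it is multiplied by \<open>x ^ (CARD('a) - 1)\<close>.
\<close>

lemma power_CARD_eq_self:
  fixes x :: "'a::{field,finite}"
  shows "x ^ CARD('a) = x"
proof (cases "x = 0")
  case False
  let ?P = "\<Prod>y\<in>UNIV - {0 :: 'a}. y"
  have "x ^ (CARD('a) - 1) * ?P = (\<Prod>y\<in>UNIV - {0}. x * y)"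
    by (simp add: prod.distrib)
  also have "\<dots> = ?P"
    by (rule prod.reindex_bij_witness[of _ "\<lambda>y. y / x" "\<lambda>y. x * y"]) (use False in auto)
  finally have "x ^ (CARD('a) - 1) = 1"
    by simp
  moreover have "x ^ CARD('a) = x * x ^ (CARD('a) - 1)"
    by (metis finite power_eq_if zero_less_card_finite less_irrefl)
  ultimately show ?thesis by simp
qed (simp add: zero_less_card_finite)

locale finite_field_extension = field_hom \<iota>
  for \<iota> :: "'a::{field,finite} \<Rightarrow> 'b::{field,finite}" +
  fixes q h :: nat
  assumes card_base: "CARD('a) = q" and card_ext: "CARD('b) = q ^ h" and h_pos: "h \<ge> 1"
begin

lemma q_ge_2: "q \<ge> 2"
proof -
  have "card {0, 1 :: 'a} \<le> CARD('a)"
    by (rule card_mono) auto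
  then show ?thesis by (simp add: card_base)
qed

lemma inj_hom: "inj \<iota>"
  by (simp add: inj_def)

text \<open>
  The polynomials \<open>(1 + X) ^ q\<close> and \<open>X ^ q + 1\<close> are monic of degree \<open>q\<close> and agree at the \<open>q\<close>
  elements of the base field, hence are equal. The identity of polynomials carries over to the
  extension field, and homogenizing it gives additivity.
\<close>

lemma add_power_q: "(x + y) ^ q = x ^ q + y ^ q" for x y :: 'b
proof -
  have base: "[:1, 1:] ^ q = monom 1 q + (1 :: 'a poly)"
  proof (rule poly_eqI_degree_lead_coeff[where n = q and A = UNIV])
    show "poly ([:1, 1:] ^ q) a = poly (monom 1 q + 1) a" for a :: 'a
      using power_CARD_eq_self[of a] power_CARD_eq_self[of "1 + a"]
      by (simp add: card_base poly_monom)
    show "coeff ([:1, 1:] ^ q) q = coeff (monom 1 q + (1 :: 'a poly)) q"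
      using q_ge_2 lead_coeff_power[of "[:1, 1 :: 'a:]" q] by (simp add: degree_power_eq)
    show "degree ([:1, 1 :: 'a:] ^ q) \<le> q"
      by (simp add: degree_power_eq)
    show "degree (monom 1 q + (1 :: 'a poly)) \<le> q"
      by (intro degree_add_le) (simp_all add: degree_monom_le)
    show "card (UNIV :: 'a set) \<ge> q"
      by (simp add: card_base)
  qed
  interpret P: map_poly_inj_idom_divide_hom \<iota> ..
  have "map_poly \<iota> ([:1, 1:] ^ q) = [:1, 1:] ^ q"
    by (simp add: P.hom_power)
  moreover have "map_poly \<iota> (monom 1 q + 1) = monom 1 q + 1"
    by (simp add: P.hom_add map_poly_monom)
  ultimately have ext: "[:1, 1:] ^ q = monom 1 q + (1 :: 'b poly)"
    using base by metis
  have one: "(1 + z) ^ q = z ^ q + 1" for z :: 'b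
    using arg_cong[OF ext, of "\<lambda>p. poly p z"] by (simp add: poly_monom)
  show ?thesis
  proof (cases "y = 0")
    case True
    then show ?thesis using q_ge_2 by simp
  next
    case False
    then have "x + y = y * (1 + x / y)"
      by (simp add: field_simps)
    then have "(x + y) ^ q = y ^ q * ((x / y) ^ q + 1)"
      by (simp only: power_mult_distrib one)
    also have "\<dots> = (y * (x / y)) ^ q + y ^ q"
      by (simp only: power_mult_distrib distrib_left mult_1_right)
    finally show ?thesis
      using False by simp
  qed
qed

lemma sum_power_q: "(\<Sum>i\<in>A. f i) ^ (q ^ l) = (\<Sum>i\<in>A. f i ^ (q ^ l) :: 'b)"
proof -
  have step: "(\<Sum>i\<in>A. g i) ^ q = (\<Sum>i\<in>A. g i ^ q :: 'b)" for g
    using q_ge_2 by (induction A rule: infinite_finite_induct) (simp_all add: add_power_q)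
  show ?thesis
    by (induction l) (simp_all add: power_mult step mult.commute[of q])
qed

lemma hom_power_q: "\<iota> x ^ (q ^ l) = \<iota> x"
proof (induction l)
  case (Suc l)
  have "\<iota> x ^ q = \<iota> x"
    using power_CARD_eq_self[of x] by (simp add: card_base hom_power[symmetric])
  then show ?case
    using Suc by (simp add: power_mult)
qed simp

lemma power_q_h: "y ^ (q ^ h) = y" for y :: 'b
  using power_CARD_eq_self[of y] by (simp add: card_ext)

text \<open>
  The base field already supplies all \<open>q\<close> roots that \<open>X ^ q - X\<close> can have.
\<close>

lemma fixed_in_range:
  assumes "y ^ q = y"
  shows "y \<in> range \<iota>"
proof -
  define p :: "'b poly" where "p = monom 1 q - monom 1 1"
  have "coeff p q = 1"
    using q_ge_2 by (simp add: p_def coeff_monom)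
  then have p0: "p \<noteq> 0" by auto
  have "degree p \<le> q"
    unfolding p_def using q_ge_2 by (intro degree_diff_le) (auto intro: order_trans[OF degree_monom_le])
  then have roots: "card {z. poly p z = 0} \<le> card (range \<iota>)"
    using card_poly_roots_bound[OF p0] inj_hom by (simp add: card_image card_base)
  have "range \<iota> \<subseteq> {z. poly p z = 0}"
    using hom_power_q[of _ 1] by (auto simp: p_def poly_monom)
  then have "range \<iota> = {z. poly p z = 0}"
    using roots by (intro card_seteq) auto
  then show ?thesis
    using assms by (auto simp: p_def poly_monom)
qed

text \<open>
  The trace from the extension field to the base field, with its values taken in the extension
  field.
\<close>

definition tr :: "'b \<Rightarrow> 'b" where
  "tr y = (\<Sum>l<h. y ^ (q ^ l))"

text \<open>
  The Frobenius map permutes the summands of the trace cyclically.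
\<close>

lemma tr_in_range: "tr y \<in> range \<iota>"
proof (rule fixed_in_range)
  have "tr y ^ q = (\<Sum>l<h. y ^ (q ^ Suc l))"
    using sum_power_q[of "\<lambda>l. y ^ (q ^ l)" "{..<h}" 1]
    by (simp add: tr_def power_mult[symmetric] mult.commute)
  also have "\<dots> + y = tr y + y ^ (q ^ h)"
    using sum.lessThan_Suc_shift[of "\<lambda>l. y ^ (q ^ l)" h] sum.lessThan_Suc[of "\<lambda>l. y ^ (q ^ l)" h]
    by (simp add: tr_def add.commute)
  finally show "tr y ^ q = tr y"
    by (simp add: power_q_h)
qed

lemma tr_sum_base: "tr (\<Sum>i\<in>A. \<iota> (c i) * y i) = (\<Sum>i\<in>A. \<iota> (c i) * tr (y i))"
proof -
  have "tr (\<Sum>i\<in>A. \<iota> (c i) * y i) = (\<Sum>l<h. \<Sum>i\<in>A. \<iota> (c i) * y i ^ (q ^ l))"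
    by (simp add: tr_def sum_power_q power_mult_distrib hom_power_q)
  also have "\<dots> = (\<Sum>i\<in>A. \<iota> (c i) * tr (y i))"
    unfolding tr_def sum_distrib_left by (rule sum.swap)
  finally show ?thesis .
qed

text \<open>
  The trace is a polynomial of degree \<open>q ^ (h - 1)\<close>, too small to vanish at \<open>q ^ h\<close> points.
\<close>

lemma tr_nonzero: "\<exists>y. tr y \<noteq> 0"
proof (rule ccontr)
  assume "\<not> ?thesis"
  then have zero: "tr y = 0" for y by simp
  \<comment> \<open>Its coefficient at \<open>1\<close> comes from \<open>l = 0\<close> only, so it is not the zero polynomial.\<close>
  define p :: "'b poly" where "p = (\<Sum>l<h. monom 1 (q ^ l))"
  have "coeff p 1 = (\<Sum>l<h. if l = 0 then 1 else 0)"
    unfolding p_def coeff_sum using q_ge_2 by (intro sum.cong) (auto simp: coeff_monom)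
  also have "\<dots> = 1"
    using h_pos by (simp add: sum.delta)
  finally have p0: "p \<noteq> 0" by auto
  have "degree p \<le> q ^ (h - 1)"
    unfolding p_def
  proof (rule degree_sum_le)
    fix l assume "l \<in> {..<h}"
    then have "q ^ l \<le> q ^ (h - 1)"
      using q_ge_2 by (intro power_increasing) auto
    then show "degree (monom (1 :: 'b) (q ^ l)) \<le> q ^ (h - 1)"
      using degree_monom_le order_trans by blast
  qed simp
  also have "\<dots> < q ^ h"
    using q_ge_2 h_pos by (intro power_strict_increasing) auto
  finally have "card {y. poly p y = 0} < CARD('b)"
    using card_poly_roots_bound[OF p0] card_ext by simp
  moreover have "{y. poly p y = 0} = UNIV"
    using zero by (auto simp: p_def poly_sum poly_monom tr_def)
  ultimately show False by simp
qed

lemma orbit_frobenius: "orbit (\<lambda>y. y ^ q) x = (\<lambda>i. x ^ (q ^ i)) ` {..<h}" for x :: 'b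
proof -
  have pow: "((\<lambda>y. y ^ q) ^^ i) x = x ^ (q ^ i)" for i
    by (induction i) (simp_all add: power_mult[symmetric] mult.commute)
  have "orbit (\<lambda>y. y ^ q) x = {((\<lambda>y. y ^ q) ^^ m) x |m. m < h}"
    using h_pos by (intro orbit_altdef_bounded) (simp_all add: pow power_q_h)
  then show ?thesis
    by (auto simp: pow)
qed

lemma self_in_orbit: "x \<in> orbit (\<lambda>y. y ^ q) x" for x :: 'b
  unfolding orbit_frobenius using h_pos by (intro image_eqI[of _ _ 0]) auto

lemma orbit_eq:
  fixes x y :: 'b
  assumes "y \<in> orbit (\<lambda>y. y ^ q) x"
  shows "orbit (\<lambda>y. y ^ q) y = orbit (\<lambda>y. y ^ q) x"
proof -
  have "x \<in> orbit (\<lambda>y. y ^ q) y"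
    using self_in_orbit assms by (rule orbit_swap)
  then show ?thesis
    using assms by (auto elim: orbit_trans)
qed

lemma orbit_hom: "orbit (\<lambda>y. y ^ q) (\<iota> x) = {\<iota> x}"
  unfolding orbit_frobenius hom_power_q using h_pos by (auto intro: image_eqI[of _ _ 0])

end

section \<open>The spaces spanned by conjugate points\<close>

context vec_space
begin

lemma subspaceI:
  assumes "W \<subseteq> carrier_vec n" "0\<^sub>v n \<in> W"
    and "\<And>v w. v \<in> W \<Longrightarrow> w \<in> W \<Longrightarrow> v + w \<in> W"
    and "\<And>c v. v \<in> W \<Longrightarrow> c \<cdot>\<^sub>v v \<in> W"
  shows "subspace class_ring W V"
  unfolding subspace_def submodule_def
  using assms vec_vs[where ?'a = 'a] vec_module[where ?'a = 'a] by simp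

lemma span_singleton_subset:
  assumes v: "v \<in> carrier_vec n"
  shows "span {v} \<subseteq> range (\<lambda>c. c \<cdot>\<^sub>v v)"
proof -
  have "subspace class_ring (range (\<lambda>c. c \<cdot>\<^sub>v v)) V"
  proof (rule subspaceI)
    show "range (\<lambda>c. c \<cdot>\<^sub>v v) \<subseteq> carrier_vec n"
      using v by auto
    show "0\<^sub>v n \<in> range (\<lambda>c. c \<cdot>\<^sub>v v)"
      using v by (intro image_eqI[of _ _ 0]) auto
    fix x y assume "x \<in> range (\<lambda>c. c \<cdot>\<^sub>v v)" "y \<in> range (\<lambda>c. c \<cdot>\<^sub>v v)"
    then show "x + y \<in> range (\<lambda>c. c \<cdot>\<^sub>v v)"
      by (auto simp: add_smult_distrib_vec[symmetric])
  next
    fix c x assume "x \<in> range (\<lambda>c. c \<cdot>\<^sub>v v)"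
    then show "c \<cdot>\<^sub>v x \<in> range (\<lambda>c. c \<cdot>\<^sub>v v)"
      by (auto simp: smult_smult_assoc)
  qed
  moreover have "{v} \<subseteq> range (\<lambda>c. c \<cdot>\<^sub>v v)"
    using v by (auto intro!: image_eqI[of _ _ 1])
  ultimately show ?thesis
    by (intro span_is_subset) (auto simp: subspace_def)
qed

lemma span_closed_ops:
  assumes "S \<subseteq> carrier_vec n"
  shows "0\<^sub>v n \<in> span S"
    and "v \<in> span S \<Longrightarrow> w \<in> span S \<Longrightarrow> v + w \<in> span S"
    and "v \<in> span S \<Longrightarrow> c \<cdot>\<^sub>v v \<in> span S"
proof -
  have "submodule class_ring (span S) V"
    using assms by (intro span_is_submodule) simp
  then interpret sm: submodule class_ring "span S" V .
  show "0\<^sub>v n \<in> span S"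
    using sm.zero_closed by simp
  show "v \<in> span S \<Longrightarrow> w \<in> span S \<Longrightarrow> v + w \<in> span S"
    using sm.m_closed[of v w] by simp
  show "v \<in> span S \<Longrightarrow> c \<cdot>\<^sub>v v \<in> span S"
    using sm.smult_closed[of c v] by simp
qed

end

definition moment_vec :: "nat \<Rightarrow> 'a::field \<Rightarrow> 'a vec" where
  "moment_vec n x = vec n (\<lambda>i. x ^ i)"

lemma scalar_prod_moment_vec:
  fixes g :: "'a::field poly"
  assumes "degree g < n"
  shows "vec n (coeff g) \<bullet> moment_vec n x = poly g x"
proof -
  have "vec_poly (vec n (coeff g)) = g"
    using assms by (intro poly_eqI) (auto simp: coeff_vec_poly coeff_eq_0)
  then have "poly g x = (\<Sum>i<n. coeff g i * x ^ i)"
    using poly_vec_poly[of "vec n (coeff g)" x] by simp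
  then show ?thesis
    by (simp add: moment_vec_def scalar_prod_def lessThan_atLeast0)
qed

lemma Psi_funpow: "(Psi q ^^ i) P = map_vec (\<lambda>x. x ^ (q ^ i)) ` P"
proof (induction i)
  case 0
  have "map_vec (\<lambda>x. x ^ (q ^ 0)) v = v" for v :: "'a vec"
    by (intro eq_vecI) auto
  then show ?case by simp
next
  case (Suc i)
  have "map_vec (\<lambda>x. x ^ q) (map_vec (\<lambda>x. x ^ (q ^ i)) v) = map_vec (\<lambda>x. x ^ (q ^ Suc i)) v"
    for v :: "'a vec"
    by (intro eq_vecI) (auto simp: power_mult[symmetric] mult.commute)
  then show ?case
    unfolding funpow.simps comp_apply Suc.IH unfolding Psi_def image_image by simp
qed

context finite_field_extension
begin

text \<open>
  The vectors that lie on one of the \<open>h\<close> conjugates of \<open>P\<^sub>\<alpha>\<close>; their span is \<open>X\<^sup>*(P\<^sub>\<alpha>)\<close>.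
\<close>

definition conj_points :: "nat \<Rightarrow> 'b \<Rightarrow> 'b vec set" where
  "conj_points n \<alpha> = (\<Union>i<h. (Psi q ^^ i) (P_pt n \<alpha>))"

lemma X_star_eq: "X_star n h q (P_pt n \<alpha>) = vspan n (conj_points n \<alpha>)"
  by (simp add: X_star_def conj_points_def)

lemma conj_points_subset:
  "conj_points n \<alpha> \<subseteq> {c \<cdot>\<^sub>v moment_vec n (\<alpha> ^ (q ^ i)) |c i. i < h}"
proof
  interpret vec_space "TYPE('b)" n .
  fix w assume "w \<in> conj_points n \<alpha>"
  then obtain i u where i: "i < h" "u \<in> P_pt n \<alpha>" "w = map_vec (\<lambda>x. x ^ (q ^ i)) u"
    by (auto simp: conj_points_def Psi_funpow)
  then have "u \<in> span {moment_vec n \<alpha>}"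
    by (simp add: P_pt_def vspan_def moment_vec_def)
  then obtain c where "u = c \<cdot>\<^sub>v moment_vec n \<alpha>"
    using span_singleton_subset[of "moment_vec n \<alpha>"] by (auto simp: moment_vec_def)
  then have "w = c ^ (q ^ i) \<cdot>\<^sub>v moment_vec n (\<alpha> ^ (q ^ i))"
    using i(3) by (intro eq_vecI)
      (auto simp: moment_vec_def power_mult_distrib power_mult[symmetric] mult.commute)
  then show "w \<in> {c \<cdot>\<^sub>v moment_vec n (\<alpha> ^ (q ^ i)) |c i. i < h}"
    using i(1) by auto
qed

lemma conj_points_carrier: "conj_points n \<alpha> \<subseteq> carrier_vec n"
  using conj_points_subset[of n \<alpha>] by (auto simp: moment_vec_def)

lemma moment_vec_in_conj_points:
  assumes "i < h"
  shows "moment_vec n (\<alpha> ^ (q ^ i)) \<in> conj_points n \<alpha>"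
proof -
  interpret vec_space "TYPE('b)" n .
  have "moment_vec n \<alpha> \<in> span {moment_vec n \<alpha>}"
    by (intro span_self) (simp add: moment_vec_def)
  then have "moment_vec n \<alpha> \<in> P_pt n \<alpha>"
    by (simp add: P_pt_def vspan_def moment_vec_def)
  moreover have "moment_vec n (\<alpha> ^ (q ^ i)) = map_vec (\<lambda>x. x ^ (q ^ i)) (moment_vec n \<alpha>)"
    by (intro eq_vecI) (auto simp: moment_vec_def power_mult[symmetric] mult.commute)
  ultimately show ?thesis
    using assms by (auto simp: conj_points_def Psi_funpow)
qed

abbreviation X :: "nat \<Rightarrow> 'b \<Rightarrow> 'a vec set" where
  "X n \<alpha> \<equiv> X_sub \<iota> n h q (P_pt n \<alpha>)"

lemma X_subspace: "VectorSpace.subspace class_ring (X n \<alpha>) (module_vec TYPE('a) n)"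
proof -
  interpret A: vec_space "TYPE('a)" n .
  interpret B: vec_space "TYPE('b)" n .
  note ops = B.span_closed_ops[OF conj_points_carrier[of n \<alpha>]]
  have mem: "v \<in> X n \<alpha> \<longleftrightarrow> v \<in> carrier_vec n \<and> map_vec \<iota> v \<in> B.span (conj_points n \<alpha>)" for v
    by (simp add: X_sub_def X_star_eq vspan_def)
  show ?thesis
  proof (rule A.subspaceI)
    show "X n \<alpha> \<subseteq> carrier_vec n"
      by (auto simp: mem)
    have zero: "map_vec \<iota> (0\<^sub>v n) = 0\<^sub>v n"
      by (intro eq_vecI) auto
    show "0\<^sub>v n \<in> X n \<alpha>"
      unfolding mem zero using ops(1) by simp
    fix v w assume vw: "v \<in> X n \<alpha>" "w \<in> X n \<alpha>"
    then have "map_vec \<iota> (v + w) = map_vec \<iota> v + map_vec \<iota> w"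
      by (intro eq_vecI) (auto simp: mem hom_add)
    then show "v + w \<in> X n \<alpha>"
      using vw ops(2) by (simp add: mem)
  next
    fix c v assume v: "v \<in> X n \<alpha>"
    then have "map_vec \<iota> (c \<cdot>\<^sub>v v) = \<iota> c \<cdot>\<^sub>v map_vec \<iota> v"
      by (intro eq_vecI) (auto simp: mem hom_mult)
    then show "c \<cdot>\<^sub>v v \<in> X n \<alpha>"
      using v ops(3) by (simp add: mem)
  qed
qed

text \<open>
  Let \<open>G\<close> be the monic polynomial of degree \<open>h\<close> with roots \<open>\<alpha> ^ (q ^ i)\<close>. The coefficient vectors
  of its shifts \<open>X ^ m * G\<close> are orthogonal to all conjugates of the point, hence to
  \<open>X\<^sup>*(P\<^sub>\<alpha>)\<close>. This says that the coordinates of a vector in that space satisfy the linear recurrence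
  with characteristic polynomial \<open>G\<close>, so that \<open>h\<close> initial zeros force all coordinates to vanish.
\<close>

lemma X_determined_by_prefix:
  assumes v: "v \<in> X n \<alpha>" and zero: "\<forall>i<h. v $ i = 0"
  shows "v = 0\<^sub>v n"
proof -
  interpret B: vec_space "TYPE('b)" n .
  have vc: "v \<in> carrier_vec n" and w: "map_vec \<iota> v \<in> B.span (conj_points n \<alpha>)"
    using v by (auto simp: X_sub_def X_star_eq vspan_def)
  define G where "G = (\<Prod>i<h. [:- (\<alpha> ^ (q ^ i)), 1:])"
  have degG: "degree G = h"
    unfolding G_def by (subst degree_prod_eq_sum_degree) auto
  have leadG: "coeff G h = 1"
    using lead_coeff_prod[of "\<lambda>i. [:- (\<alpha> ^ (q ^ i)), 1:]" "{..<h}"] degG by (simp add: G_def)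
  have rootG: "poly G (\<alpha> ^ (q ^ i)) = 0" if "i < h" for i
    using that by (auto simp: G_def poly_prod)
  have recurrence: "(\<Sum>i<n. coeff (monom 1 m * G) i * \<iota> (v $ i)) = 0" if "m + h < n" for m
  proof -
    have "degree (monom 1 m * G) \<le> m + h"
      using degree_mult_le[of "monom 1 m" G] degree_monom_le[of "1 :: 'b" m] degG by linarith
    then have "degree (monom 1 m * G) < n"
      using that by simp
    note sp = scalar_prod_moment_vec[OF this]
    let ?s = "vec n (coeff (monom 1 m * G))"
    have "?s \<bullet> w = 0" if wS: "w \<in> conj_points n \<alpha>" for w
    proof -
      obtain c i where ci: "i < h" "w = c \<cdot>\<^sub>v moment_vec n (\<alpha> ^ (q ^ i))"
        using conj_points_subset[of n \<alpha>] wS by auto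
      then have "?s \<bullet> w = c * (?s \<bullet> moment_vec n (\<alpha> ^ (q ^ i)))"
        by (simp add: moment_vec_def)
      also have "\<dots> = 0"
        using ci(1) by (simp only: sp) (simp add: rootG)
      finally show ?thesis .
    qed
    then have "?s \<in> B.orthogonal_complement (conj_points n \<alpha>)"
      by (simp add: B.orthogonal_complement_def)
    then have "?s \<in> B.orthogonal_complement (B.span (conj_points n \<alpha>))"
      using B.in_orthogonal_complement_span[OF conj_points_carrier] by simp
    then have "?s \<bullet> map_vec \<iota> v = 0"
      using w by (simp add: B.orthogonal_complement_def)
    then show ?thesis
      using vc by (simp add: scalar_prod_def lessThan_atLeast0)
  qed
  have "v $ i = 0" if "i < n" for i
    using that
  proof (induction i rule: less_induct)
    case (less i)
    show ?case
    proof (cases "i < h")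
      case True
      then show ?thesis using zero by simp
    next
      case False
      define m where "m = i - h"
      have i: "i = m + h"
        using False by (simp add: m_def)
      have "coeff (monom 1 m * G) j * \<iota> (v $ j) = (if j = i then \<iota> (v $ i) else 0)" if "j < n" for j
      proof -
        consider "j < i" | "j = i" | "j > i" by linarith
        then show ?thesis
        proof cases
          case 1
          then show ?thesis using less that by simp
        next
          case 2
          then show ?thesis using leadG by (simp add: coeff_monom_mult i)
        next
          case 3
          then show ?thesis using degG by (simp add: coeff_monom_mult coeff_eq_0 i)
        qed
      qed
      then have "(\<Sum>j<n. coeff (monom 1 m * G) j * \<iota> (v $ j)) = (\<Sum>j<n. if j = i then \<iota> (v $ i) else 0)"
        by (intro sum.cong) auto
      then have "\<iota> (v $ i) = 0"
        using recurrence[of m] less.prems i by simp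
      then show ?thesis by simp
    qed
  qed
  then show ?thesis
    using vc by (intro eq_vecI) auto
qed

lemma X_dim_le:
  assumes "h \<le> n"
  shows "vectorspace.dim class_ring ((module_vec TYPE('a) n)\<lparr>carrier := X n \<alpha>\<rparr>) \<le> h"
proof -
  interpret A: vec_space "TYPE('a)" n .
  show ?thesis
    using X_subspace assms X_determined_by_prefix by (rule A.dim_le_if_determined_by_prefix)
qed

text \<open>
  Partial sums are included so that the conjugates can be added one at a time.
\<close>

lemma moment_sum_in_span:
  "vec n (\<lambda>i. \<Sum>l<m. c l * (\<alpha> ^ (q ^ l)) ^ i) \<in> vspan n (conj_points n \<alpha>)" if "m \<le> h"
  using that
proof (induction m)
  interpret B: vec_space "TYPE('b)" n .
  note ops = B.span_closed_ops[OF conj_points_carrier[of n \<alpha>]]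
  {
    case 0
    have "vec n (\<lambda>i. \<Sum>l<0. c l * (\<alpha> ^ (q ^ l)) ^ i) = 0\<^sub>v n"
      by (intro eq_vecI) auto
    then show ?case
      using ops(1) by (simp add: vspan_def)
  next
    case (Suc m)
    have "moment_vec n (\<alpha> ^ (q ^ m)) \<in> B.span (conj_points n \<alpha>)"
      using moment_vec_in_conj_points[of m n \<alpha>] B.in_own_span[OF conj_points_carrier] Suc.prems
      by auto
    moreover have "vec n (\<lambda>i. \<Sum>l<Suc m. c l * (\<alpha> ^ (q ^ l)) ^ i) =
        vec n (\<lambda>i. \<Sum>l<m. c l * (\<alpha> ^ (q ^ l)) ^ i) + c m \<cdot>\<^sub>v moment_vec n (\<alpha> ^ (q ^ m))"
      by (intro eq_vecI) (auto simp: moment_vec_def)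
    ultimately show ?case
      using Suc ops(2,3) by (simp add: vspan_def)
  }
qed

text \<open>
  Expanding the traces turns this vector into the combination of the conjugates of
  \<open>moment_vec n \<alpha>\<close> with coefficients \<open>\<beta> ^ (q ^ l)\<close>.
\<close>

lemma trace_vec_in_X:
  "vec n (\<lambda>i. inv_into UNIV \<iota> (tr (\<beta> * \<alpha> ^ i))) \<in> X n \<alpha>"
proof -
  have "map_vec \<iota> (vec n (\<lambda>i. inv_into UNIV \<iota> (tr (\<beta> * \<alpha> ^ i)))) = vec n (\<lambda>i. tr (\<beta> * \<alpha> ^ i))"
    by (intro eq_vecI) (auto simp: f_inv_into_f[OF tr_in_range])
  also have "\<dots> = vec n (\<lambda>i. \<Sum>l<h. \<beta> ^ (q ^ l) * (\<alpha> ^ (q ^ l)) ^ i)"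
    by (simp add: tr_def power_mult_distrib power_mult[symmetric] mult.commute)
  finally have "map_vec \<iota> (vec n (\<lambda>i. inv_into UNIV \<iota> (tr (\<beta> * \<alpha> ^ i)))) = \<dots>" .
  then show ?thesis
    using moment_sum_in_span[of h n "\<lambda>l. \<beta> ^ (q ^ l)" \<alpha>] by (simp add: X_sub_def X_star_eq)
qed

lemma poly_ext_power_q:
  "poly (map_poly \<iota> p) (x ^ (q ^ l)) = poly (map_poly \<iota> p) x ^ (q ^ l)"
proof -
  have "poly (map_poly \<iota> p) y = (\<Sum>i\<le>degree p. \<iota> (coeff p i) * y ^ i)" for y
    by (simp add: poly_altdef degree_map_poly coeff_map_poly)
  then show ?thesis
    by (simp add: sum_power_q power_mult_distrib hom_power_q power_mult[symmetric] mult.commute)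
qed

text \<open>
  On the trace vector belonging to \<open>\<beta>\<close> the form takes the value \<open>tr (\<beta> * F \<alpha>)\<close>, where \<open>F\<close> is its
  polynomial. If \<open>F \<alpha>\<close> were nonzero, then \<open>\<beta> * F \<alpha>\<close> would run through the whole field and the
  trace would vanish identically.
\<close>

lemma annihilator_X:
  assumes f: "f \<in> carrier_vec n" and ann: "\<And>v. v \<in> X n \<alpha> \<Longrightarrow> f \<bullet> v = 0"
    and x: "x \<in> orbit (\<lambda>y. y ^ q) \<alpha>"
  shows "poly (map_poly \<iota> (vec_poly f)) x = 0"
proof -
  have "map_poly \<iota> (vec_poly f) = vec_poly (map_vec \<iota> f)"
    by (intro poly_eqI) (auto simp: coeff_map_poly coeff_vec_poly)
  then have F: "poly (map_poly \<iota> (vec_poly f)) \<alpha> = (\<Sum>i<n. \<iota> (f $ i) * \<alpha> ^ i)"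
    using f by (simp add: poly_vec_poly)
  have tr0: "tr (\<beta> * (\<Sum>i<n. \<iota> (f $ i) * \<alpha> ^ i)) = 0" for \<beta>
  proof -
    have "tr (\<beta> * (\<Sum>i<n. \<iota> (f $ i) * \<alpha> ^ i)) = tr (\<Sum>i<n. \<iota> (f $ i) * (\<beta> * \<alpha> ^ i))"
      by (simp add: sum_distrib_left mult_ac)
    also have "\<dots> = (\<Sum>i<n. \<iota> (f $ i) * tr (\<beta> * \<alpha> ^ i))"
      by (rule tr_sum_base)
    also have "\<dots> = \<iota> (f \<bullet> vec n (\<lambda>i. inv_into UNIV \<iota> (tr (\<beta> * \<alpha> ^ i))))"
      by (simp add: scalar_prod_def hom_sum hom_mult f_inv_into_f[OF tr_in_range] lessThan_atLeast0)
    also have "\<dots> = 0"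
      by (simp add: ann trace_vec_in_X)
    finally show ?thesis .
  qed
  have "poly (map_poly \<iota> (vec_poly f)) \<alpha> = 0"
  proof (rule ccontr)
    assume nz: "poly (map_poly \<iota> (vec_poly f)) \<alpha> \<noteq> 0"
    obtain y where "tr y \<noteq> 0"
      using tr_nonzero by blast
    with tr0[of "y / poly (map_poly \<iota> (vec_poly f)) \<alpha>"] nz show False
      by (simp add: F)
  qed
  then show ?thesis
    using x q_ge_2 by (auto simp: orbit_frobenius poly_ext_power_q)
qed

end

section \<open>Counting zeros on the projective line\<close>

text \<open>
  The order of vanishing at a point of the projective line, for nonzero \<open>p\<close> regarded as a binary form of
  degree \<open>n - 1\<close>; the point \<open>None\<close> is infinity.
\<close>

definition zero_order :: "nat \<Rightarrow> 'a::field poly \<Rightarrow> 'a option \<Rightarrow> nat" where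
  "zero_order n p z = (case z of None \<Rightarrow> n - 1 - degree p | Some x \<Rightarrow> Polynomial.order x p)"

lemma sum_zero_order_le:
  fixes p :: "'a::{field,finite} poly"
  assumes p: "p \<noteq> 0" and deg: "degree p \<le> n - 1"
  shows "(\<Sum>z\<in>S. zero_order n p z) \<le> n - 1"
proof -
  have "(\<Sum>z\<in>S. zero_order n p z) \<le> (\<Sum>z\<in>UNIV. zero_order n p z)"
    by (rule sum_mono2) auto
  also have "\<dots> = (n - 1 - degree p) + (\<Sum>x\<in>UNIV. Polynomial.order x p)"
    by (simp add: UNIV_option_conv zero_order_def sum.reindex)
  also have "(\<Sum>x\<in>UNIV. Polynomial.order x p) = (\<Sum>x | poly p x = 0. Polynomial.order x p)"
    by (rule sum.mono_neutral_right) (auto simp: order_0I)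
  also have "n - 1 - degree p + \<dots> \<le> n - 1"
    using sum_order_le_degree[OF p] deg by linarith
  finally show ?thesis .
qed

context finite_field_extension
begin

text \<open>
  The Frobenius orbit of a point of the projective line over the extension field. Members of the
  family will be indexed by points whose orbits are disjoint.
\<close>

definition conj_class :: "'b option \<Rightarrow> 'b option set" where
  "conj_class z = (case z of None \<Rightarrow> {None} | Some x \<Rightarrow> Some ` orbit (\<lambda>y. y ^ q) x)"

text \<open>
  Indexing both kinds of spaces by points of one projective line makes them instances of the same
  rule: a form annihilating the space has at least \<open>h\<close> zeros on the orbit of the point.
\<close>

definition arc_space :: "nat \<Rightarrow> 'b option \<Rightarrow> 'a vec set" where
  "arc_space n z = (case z of
     None \<Rightarrow> osc n h (vec n (\<lambda>i. monom 1 (n - 1 - i))) 0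
   | Some x \<Rightarrow>
       if x \<in> range \<iota> then osc n h (vec n (monom 1)) (inv_into UNIV \<iota> x) else X n x)"

lemma arc_space_subspace:
  "VectorSpace.subspace class_ring (arc_space n z) (module_vec TYPE('a) n)"
  by (simp add: arc_space_def osc_subspace(1) X_subspace split: option.split)

lemma arc_space_dim_le:
  assumes "h \<le> n"
  shows "vectorspace.dim class_ring ((module_vec TYPE('a) n)\<lparr>carrier := arc_space n z\<rparr>) \<le> h"
  by (simp add: arc_space_def osc_subspace(2) X_dim_le[OF assms] split: option.split)

text \<open>
  A rational point, and infinity, is its own orbit and must be a zero of order \<open>h\<close>; a point outside
  the base field contributes \<open>h\<close> different conjugate zeros.
\<close>

lemma zero_order_if_annihilates:
  assumes hn: "h \<le> n"
    and fact: "\<And>j. j < h \<Longrightarrow> of_nat (fact j) \<noteq> (0 :: 'a)"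
    and z: "z \<in> insert None (Some ` (range \<iota> \<union> \<Union>(full_orbits h q)))"
    and f: "f \<in> carrier_vec n" "f \<noteq> 0\<^sub>v n"
    and ann: "\<And>v. v \<in> arc_space n z \<Longrightarrow> f \<bullet> v = 0"
  shows "h \<le> (\<Sum>y\<in>conj_class z. zero_order n (map_poly \<iota> (vec_poly f)) y)"
proof -
  interpret P: map_poly_inj_idom_divide_hom \<iota> ..
  let ?F = "map_poly \<iota> (vec_poly f)"
  have p0: "vec_poly f \<noteq> 0"
    using f vec_poly_eq_0_iff by blast
  have F0: "?F \<noteq> 0"
    using p0 by simp
  have orbits: "card (orbit (\<lambda>y. y ^ q) x) = h" if "x \<in> \<Union>(full_orbits h q)" for x :: 'b
    using that orbit_eq by (auto simp: full_orbits_def)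
  consider "z = None" | t where "z = Some (\<iota> t)"
    | x where "z = Some x" "x \<notin> range \<iota>" "card (orbit (\<lambda>y. y ^ q) x) = h"
    using z orbits by auto
  then show ?thesis
  proof cases
    case 1
    have "f $ i = 0" if i: "n - h \<le> i" "i < n" for i
    proof -
      define j where "j = n - 1 - i"
      have j: "j < h" "j < n" "n - 1 - j = i"
        using i hn by (auto simp: j_def)
      have "map_vec (\<lambda>g. poly ((pderiv ^^ j) g) 0) (vec n (\<lambda>i. monom 1 (n - 1 - i))) \<in> arc_space n z"
        using in_osc[of "vec n (\<lambda>i. monom 1 (n - 1 - i))" n j h 0] j(1)
        by (simp add: arc_space_def 1)
      from ann[OF this] have "of_nat (fact j) * f $ i = 0"
        using scalar_prod_reversed_moment_curve_derivative[OF f(1) j(2)] j(3) by simp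
      then show ?thesis
        using fact[OF j(1)] by simp
    qed
    then have "coeff (vec_poly f) i = 0" if "i \<ge> n - h" for i
      using that f(1) by (simp add: coeff_vec_poly)
    then have "degree (vec_poly f) < n - h"
      using p0 leading_coeff_0_iff by (metis not_le)
    then show ?thesis
      by (simp add: 1 conj_class_def zero_order_def)
  next
    case (2 t)
    have "poly ((pderiv ^^ j) (vec_poly f)) t = 0" if "j < h" for j
    proof -
      have "map_vec (\<lambda>g. poly ((pderiv ^^ j) g) t) (vec n (monom 1)) \<in> arc_space n z"
        using in_osc[of "vec n (monom 1)" n j h t] that inj_hom by (simp add: arc_space_def 2)
      from ann[OF this] show ?thesis
        using scalar_prod_moment_curve_derivative[OF f(1), of j t] by simp
    qed
    then have "[:- t, 1:] ^ h dvd vec_poly f"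
      using fact by (rule power_dvd_if_higher_pderivs_vanish)
    then have "h \<le> Polynomial.order t (vec_poly f)"
      using p0 by (simp add: order_divides)
    then show ?thesis
      by (simp add: 2 conj_class_def orbit_hom zero_order_def P.order_hom)
  next
    case (3 x)
    have "1 \<le> Polynomial.order y ?F" if "y \<in> orbit (\<lambda>y. y ^ q) x" for y
    proof -
      have "poly ?F y = 0"
        using f(1) _ that by (rule annihilator_X) (use ann 3 in \<open>simp add: arc_space_def\<close>)
      then show ?thesis
        using F0 by (simp add: order_root Suc_le_eq)
    qed
    then have "(\<Sum>y\<in>orbit (\<lambda>y. y ^ q) x. 1) \<le> (\<Sum>y\<in>orbit (\<lambda>y. y ^ q) x. Polynomial.order y ?F)"
      by (intro sum_mono) auto
    then show ?thesis
      using 3 by (simp add: conj_class_def zero_order_def sum.reindex)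
  qed
qed

text \<open>
  A nonzero form annihilating all the spaces would have \<open>h\<close> zeros on each of \<open>k\<close> disjoint orbits,
  but a form of degree \<open>h * k - 1\<close> has at most that many zeros.
\<close>

lemma arc_spaces_span:
  assumes n: "n = h * k" and k: "k \<ge> 1"
    and fact: "\<And>j. j < h \<Longrightarrow> of_nat (fact j) \<noteq> (0 :: 'a)"
    and J: "J \<subseteq> insert None (Some ` (range \<iota> \<union> \<Union>(full_orbits h q)))" "card J = k"
    and disj: "\<And>y z. y \<in> J \<Longrightarrow> z \<in> J \<Longrightarrow> y \<noteq> z \<Longrightarrow> conj_class y \<inter> conj_class z = {}"
  shows "vspan n (\<Union>z\<in>J. arc_space n z) = carrier_vec n"
proof -
  interpret vec_space "TYPE('a)" n .
  interpret P: map_poly_inj_idom_divide_hom \<iota> ..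
  have hn: "h \<le> n"
    using n k by simp
  have "span (\<Union>z\<in>J. arc_space n z) = carrier_vec n"
  proof (rule span_eq_carrier_if_orthogonal_trivial)
    have "arc_space n z \<subseteq> carrier_vec n" for z
      using arc_space_subspace[of n z] by (simp add: VectorSpace.subspace_def submodule_def)
    then show "(\<Union>z\<in>J. arc_space n z) \<subseteq> carrier_vec n"
      by blast
    fix f assume f: "f \<in> carrier_vec n" and ann: "\<forall>v\<in>\<Union>z\<in>J. arc_space n z. f \<bullet> v = 0"
    show "f = 0\<^sub>v n"
    proof (rule ccontr)
      assume f0: "f \<noteq> 0\<^sub>v n"
      define F where "F = map_poly \<iota> (vec_poly f)"
      have F0: "F \<noteq> 0"
        using f f0 vec_poly_eq_0_iff by (auto simp: F_def)
      have degF: "degree F \<le> n - 1"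
        using degree_vec_poly_le[OF f] by (simp add: F_def)
      have "k * h = (\<Sum>z\<in>J. h)"
        using J(2) by simp
      also have "\<dots> \<le> (\<Sum>z\<in>J. \<Sum>y\<in>conj_class z. zero_order n F y)"
      proof (rule sum_mono)
        fix z assume z: "z \<in> J"
        show "h \<le> (\<Sum>y\<in>conj_class z. zero_order n F y)"
          unfolding F_def
        proof (rule zero_order_if_annihilates[OF hn fact _ f f0])
          show "z \<in> insert None (Some ` (range \<iota> \<union> \<Union>(full_orbits h q)))"
            using z J(1) by blast
          show "f \<bullet> v = 0" if "v \<in> arc_space n z" for v
            using that z ann by blast
        qed
      qed
      also have "\<dots> = (\<Sum>y\<in>(\<Union>z\<in>J. conj_class z). zero_order n F y)"
        using disj by (intro sum.UNION_disjoint[symmetric]) auto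
      also have "\<dots> \<le> n - 1"
        using F0 degF by (rule sum_zero_order_le)
      finally have "k * h \<le> n - 1" .
      moreover have "k * h = n"
        by (simp add: n mult.commute)
      moreover have "n \<ge> 1"
        using h_pos hn by linarith
      ultimately show False
        by linarith
    qed
  qed
  then show ?thesis
    by (simp add: vspan_def)
qed

end

theorem theorem3p11:
  fixes h k p q :: nat
    and \<iota> :: "'a::{field,finite} \<Rightarrow> 'b::{field,finite}"
    and \<Lambda> :: "'b set"
  assumes "h \<ge> 2" and "k \<ge> 2"
    and "CARD('a) = q" and "CARD('b) = q ^ h" and "field_hom \<iota>"
    and "q \<ge> h * k + 1"
    and "CHAR('a) = p" and "p \<ge> h"
    and "orbit_reps h q \<Lambda>"
  shows "pseudo_arc h k (P_family \<iota> h k q \<Lambda> \<union> O_family h k) \<and>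
         card (P_family \<iota> h k q \<Lambda> \<union> O_family h k) = card \<Lambda> + q + 1"
proof -
  interpret field_hom \<iota> by fact
  interpret finite_field_extension \<iota> q h
    using assms by unfold_locales auto
  let ?n = "h * k"
  have hn: "h \<le> ?n"
    using assms(2) by simp
  have fact: "of_nat (fact j) \<noteq> (0 :: 'a)" if "j < h" for j
  proof -
    have "prime p"
      using assms(7) prime_CHAR_semidom[where ?'a = 'a] finite_imp_CHAR_pos[where ?'a = 'a] by simp
    then have "\<not> p dvd fact j"
      using that assms(8) by (simp add: prime_dvd_fact_iff)
    then show ?thesis
      using assms(7) by (simp add: of_nat_eq_0_iff_char_dvd)
  qed
  have \<Lambda>_sub: "\<Lambda> \<subseteq> \<Union>(full_orbits h q)"
    and \<Lambda>_unique: "\<And>Q. Q \<in> full_orbits h q \<Longrightarrow> \<exists>!\<alpha>. \<alpha> \<in> \<Lambda> \<inter> Q"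
    using assms(9) by (auto simp: orbit_reps_def)
  have orbit_full: "orbit (\<lambda>y. y ^ q) x \<in> full_orbits h q" if "x \<in> \<Lambda>" for x
    using that \<Lambda>_sub orbit_eq by (auto simp: full_orbits_def)
  have \<Lambda>_irrational: "\<Lambda> \<inter> range \<iota> = {}"
  proof -
    have False if "\<iota> t \<in> \<Lambda>" for t
      using orbit_full[OF that] assms(1) by (simp add: full_orbits_def orbit_hom)
    then show ?thesis by auto
  qed
  \<comment> \<open>One point for each member: infinity, the rational points, and the representatives \<open>\<Lambda>\<close>.\<close>
  define I where "I = insert None (Some ` (range \<iota> \<union> \<Lambda>))"
  have cardI: "card I = card \<Lambda> + q + 1"
  proof -
    have "card (range \<iota> \<union> \<Lambda>) = q + card \<Lambda>"
      using \<Lambda>_irrational inj_hom assms(3) by (subst card_Un_disjoint) (auto simp: card_image)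
    then show ?thesis
      by (simp add: I_def card_image)
  qed
  have image: "arc_space ?n ` I = P_family \<iota> h k q \<Lambda> \<union> O_family h k"
  proof -
    have "arc_space ?n (Some x) = X ?n x" if "x \<in> \<Lambda>" for x
      using that \<Lambda>_irrational by (auto simp: arc_space_def)
    moreover have "arc_space ?n (Some (\<iota> t)) = osc ?n h (vec ?n (monom 1)) t" for t
      using inj_hom by (simp add: arc_space_def)
    ultimately show ?thesis
      unfolding I_def P_family_def O_family_def
      by (simp add: image_Un image_image arc_space_def[of _ None] Un_commute)
  qed
  have disj: "conj_class y \<inter> conj_class z = {}" if "y \<in> I" "z \<in> I" "y \<noteq> z" for y z
  proof (rule ccontr)
    assume "conj_class y \<inter> conj_class z \<noteq> {}"
    then obtain w where w: "w \<in> conj_class y" "w \<in> conj_class z" by blast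
    show False
    proof (cases w)
      case None
      then show ?thesis
        using w that by (auto simp: conj_class_def split: option.splits)
    next
      case (Some u)
      then obtain a b where ab: "y = Some a" "z = Some b"
        "u \<in> orbit (\<lambda>y. y ^ q) a" "u \<in> orbit (\<lambda>y. y ^ q) b"
        using w by (auto simp: conj_class_def split: option.splits)
      then have same: "orbit (\<lambda>y. y ^ q) a = orbit (\<lambda>y. y ^ q) b"
        using orbit_eq by metis
      have mem: "a \<in> range \<iota> \<union> \<Lambda>" "b \<in> range \<iota> \<union> \<Lambda>"
        using that ab by (auto simp: I_def)
      have "a = b"
      proof (cases "a \<in> \<Lambda> \<and> b \<in> \<Lambda>")
        case True
        then show ?thesis
          using \<Lambda>_unique[OF orbit_full[of a]] self_in_orbit[of a] self_in_orbit[of b] same by auto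
      next
        case False
        then have "orbit (\<lambda>y. y ^ q) a = {a} \<or> orbit (\<lambda>y. y ^ q) b = {b}"
          using mem orbit_hom by auto
        then show ?thesis
          using same self_in_orbit[of a] self_in_orbit[of b] by auto
      qed
      then show ?thesis
        using ab that(3) by simp
    qed
  qed
  have I_sub: "I \<subseteq> insert None (Some ` (range \<iota> \<union> \<Union>(full_orbits h q)))"
    using \<Lambda>_sub by (auto simp: I_def)
  have spans: "vspan ?n (\<Union>z\<in>J. arc_space ?n z) = carrier_vec ?n" if "J \<subseteq> I" "card J = k" for J
  proof (rule arc_spaces_span[OF refl _ fact])
    show "k \<ge> 1"
      using assms(2) by simp
    show "conj_class y \<inter> conj_class z = {}" if "y \<in> J" "z \<in> J" "y \<noteq> z" for y z
      using disj[of y z] that \<open>J \<subseteq> I\<close> by blast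
  qed (use that I_sub in auto)
  have "k \<le> card I"
  proof -
    have "1 * k \<le> h * k"
      using assms(1) by (intro mult_le_mono1) simp
    then show ?thesis
      using assms(6) cardI by linarith
  qed
  moreover have "finite I"
    by simp
  ultimately have "pseudo_arc h k (arc_space ?n ` I)" "card (arc_space ?n ` I) = card I"
    using pseudo_arc_of_spanning_family[of h k I "arc_space ?n"] assms(1,2)
      arc_space_subspace[of ?n] arc_space_dim_le[OF hn] spans by simp_all
  then show ?thesis
    unfolding image cardI by simp
qed

end
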